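(* Let $k\in\{1,\dots,d-1\}$, let $x_n,x_{n+1}$ be two successive iterates with symmetric matrices $H(x_n),H(x_{n+1})\in\mathbb{R}^{d\times d}$, and write $\lambda_{i,n}=\lambda_i(H(x_n))$, $\lambda_{i,n+1}=\lambda_i(H(x_{n+1}))$ for $i=k,k+1$. Suppose that real endpoint estimates $\widehat\lambda_{k,n},\widehat\lambda_{k+1,n}$ satisfy $$|\widehat\lambda_{k,n}-\lambda_{k,n}|\le\varepsilon_n,\qquad|\widehat\lambda_{k+1,n}-\lambda_{k+1,n}|\le\varepsilon_n.$$ For a candidate shift $s_n\in\mathbb{R}$, define its estimated margin $$\widehat m_n=\min\{s_n-\widehat\lambda_{k,n},\ \widehat\lambda_{k+1,n}-s_n\}.$$ (1) If $\widehat m_n>\varepsilon_n$, then $s_n$ is admissible at $x_n$, with true margin at least $\widehat m_n-\varepsilon_n$. (2) Moreover, if $\widehat m_n>\varepsilon_n$ and the next-step endpoint drift obeys $$\Delta_n:=\max_{i=k,k+1}|\lambda_{i,n+1}-\lambda_{i,n}|\le\delta_n<\widehat m_n-\varepsilon_n,$$ then the same shift $s_n$ remains admissible at $x_{n+1}$, with true margin at least $\widehat m_n-\varepsilon_n-\delta_n$. In particular, the drift bound $\Delta_n\le\delta_n$ holds whenever $\|H(x_{n+1})-H(x_n)\|_2\le\delta_n$. (3) Finally, if at $x_{n+1}$ the true gap $g_{n+1}=\lambda_{k+1,n+1}-\lambda_{k,n+1}$ is positive and fresh endpoint estimates $\widehat\lambda_{k,n+1},\widehat\lambda_{k+1,n+1}$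 of $\lambda_{k,n+1},\lambda_{k+1,n+1}$ have error at most $\varepsilon_{n+1}<g_{n+1}/2$, then the estimated midpoint $$\widehat s_{n+1}=\frac{\widehat\lambda_{k,n+1}+\widehat\lambda_{k+1,n+1}}{2}$$ is admissible at $x_{n+1}$.
   Context: For symmetric $A\in\mathbb{R}^{d\times d}$, $\lambda_1(A)\le\cdots\le\lambda_d(A)$ are its ordered eigenvalues. A shift $s$ is admissible at $x$ (for target index $k$) if $s\in(\lambda_k(H(x)),\lambda_{k+1}(H(x)))$; its true margin at $x$ is $\min\{s-\lambda_k(H(x)),\ \lambda_{k+1}(H(x))-s\}$. $\|\cdot\|_2$ is the spectral norm. *)

theory Defs
  imports "HOL-Analysis.Analysis" "HOL-Computational_Algebra.Computational_Algebra"
begin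

definition charpoly :: "real ^ 'd ^ 'd \<Rightarrow> real poly" where
  "charpoly A = det (mat [:0, 1:] - map_matrix (\<lambda>a. [:a:]) A)"

text \<open>The real eigenvalues, counted with algebraic multiplicity.  For symmetric matrices these
  are all the eigenvalues, \<open>CARD('d)\<close> in number.\<close>

definition eigvals :: "real ^ 'd ^ 'd \<Rightarrow> real multiset" where
  "eigvals A = proots (charpoly A)"

text \<open>\<open>lam i A\<close> is the \<open>i\<close>-th smallest eigenvalue, with \<open>i\<close> counted from 1.  It is meaningful for
  symmetric \<open>A\<close> and \<open>1 \<le> i \<le> CARD('d)\<close> only.\<close>

definition lam :: "nat \<Rightarrow> real ^ 'd ^ 'd \<Rightarrow> real" where
  "lam i A = sorted_list_of_multiset (eigvals A) ! (i - 1)"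

definition symmetric_matrix :: "real ^ 'd ^ 'd \<Rightarrow> bool" where
  "symmetric_matrix A \<longleftrightarrow> transpose A = A"

text \<open>The norm on \<open>real ^ 'd\<close> is Euclidean, so its operator norm is the spectral norm.\<close>

definition spectral_norm :: "real ^ 'd ^ 'd \<Rightarrow> real" where
  "spectral_norm A = onorm ((*v) A)"

definition admissible :: "('x \<Rightarrow> real ^ 'd ^ 'd) \<Rightarrow> nat \<Rightarrow> 'x \<Rightarrow> real \<Rightarrow> bool" where
  "admissible H k x s \<longleftrightarrow> s \<in> {lam k (H x) <..< lam (k + 1) (H x)}"

definition true_margin :: "('x \<Rightarrow> real ^ 'd ^ 'd) \<Rightarrow> nat \<Rightarrow> 'x \<Rightarrow> real \<Rightarrow> real" where
  "true_margin H k x s = min (s - lam k (H x)) (lam (k + 1) (H x) - s)"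

definition estimated_margin :: "real \<Rightarrow> real \<Rightarrow> real \<Rightarrow> real" where
  "estimated_margin l u s = min (s - l) (u - s)"

definition endpoint_drift :: "('x \<Rightarrow> real ^ 'd ^ 'd) \<Rightarrow> nat \<Rightarrow> 'x \<Rightarrow> 'x \<Rightarrow> real" where
  "endpoint_drift H k x y = (MAX i\<in>{k, k + 1}. \<bar>lam i (H y) - lam i (H x)\<bar>)"

lemma poly_charpoly: "poly (charpoly A) t = det (mat t - A)"
  by (simp add: charpoly_def det_def poly_sum poly_prod mat_def of_int_poly if_distrib
      [of "\<lambda>p. poly p t"] cong: if_cong)

lemma poly_charpoly_eq_0_iff:
  "poly (charpoly A) t = 0 \<longleftrightarrow> (\<exists>v. v \<noteq> 0 \<and> A *v v = t *\<^sub>R v)"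
proof -
  have "mat t *v v = t *\<^sub>R v" for v :: "real ^ 'd"
    by (simp add: vec_eq_iff matrix_vector_mult_def mat_def if_distrib [of "\<lambda>a. a * _"] cong: if_cong)
  then have "(mat t - A) *v v = 0 \<longleftrightarrow> A *v v = t *\<^sub>R v" for v
    by (metis matrix_vector_mult_diff_rdistrib right_minus_eq)
  moreover have "det (mat t - A) = 0 \<longleftrightarrow> (\<exists>v. v \<noteq> 0 \<and> (mat t - A) *v v = 0)"
    by (metis invertible_det_nz invertible_left_inverse matrix_left_invertible_ker)
  ultimately show ?thesis
    by (simp add: poly_charpoly)
qed

lemma charpoly_nonzero: "charpoly A \<noteq> 0"
proof
  assume "charpoly A = 0"
  then obtain v where v: "v \<noteq> 0" "A *v v = (onorm ((*v) A) + 1) *\<^sub>R v"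
    using poly_charpoly_eq_0_iff [of A "onorm ((*v) A) + 1"] by auto
  have "norm (A *v v) \<le> onorm ((*v) A) * norm v"
    by (rule onorm) (simp add: matrix_vector_mul_bounded_linear)
  moreover have "onorm ((*v) A) \<ge> 0"
    by (simp add: onorm_pos_le matrix_vector_mul_bounded_linear)
  moreover have "norm (A *v v) = \<bar>onorm ((*v) A) + 1\<bar> * norm v"
    by (simp only: v(2) norm_scaleR)
  ultimately show False
    using v(1) by (simp add: distrib_right)
qed

lemma set_eigvals: "set_mset (eigvals A) = {t. \<exists>v. v \<noteq> 0 \<and> A *v v = t *\<^sub>R v}"
  by (simp add: eigvals_def charpoly_nonzero poly_charpoly_eq_0_iff)

end

theory Submission
  imports Defs
begin

text \<open>
  Given bounds on the error of the endpoint estimates and on the drift of the endpoints, the claims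
  about margins and midpoints are the triangle inequality on the real line.  The only fact about
  matrices is that the drift is at most the spectral norm of the increment of \<open>H\<close>.  This is Weyl's
  perturbation inequality \<open>\<bar>\<lambda>\<^sub>i(B) - \<lambda>\<^sub>i(A)\<bar> \<le> \<parallel>B - A\<parallel>\<close> for symmetric \<open>A\<close> and \<open>B\<close>, proved in
  \<open>abs_lam_diff_le_spectral_norm\<close>.

  Weyl's inequality comes from counting dimensions.  Let \<open>t = \<lambda>\<^sub>i(A)\<close> and \<open>r = \<parallel>B - A\<parallel>\<close>.  On the
  span of the eigenvectors of \<open>A\<close> with eigenvalue at most \<open>t\<close>, a space of dimension at least \<open>i\<close>,
  the Rayleigh quotient of \<open>A\<close> is at most \<open>t\<close>, so that of \<open>B\<close> is at most \<open>t + r\<close>.  On the span of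
  the eigenvectors of \<open>B\<close> with eigenvalue above \<open>t + r\<close> the Rayleigh quotient of \<open>B\<close> exceeds
  \<open>t + r\<close>.  The two spans therefore meet only in \<open>0\<close>, the second has dimension at most \<open>d - i\<close>, and
  at least \<open>i\<close> eigenvalues of \<open>B\<close> are at most \<open>t + r\<close>.

  The argument needs an orthonormal eigenbasis (\<open>symmetric_matrix_orthonormal_eigenbasis\<close>), found by
  repeatedly maximising the Rayleigh quotient on the orthogonal complement of the eigenvectors
  obtained so far.  Since \<open>lam\<close> is defined through the roots of the characteristic polynomial,
  it also needs that these roots, with multiplicity, are the eigenvalues along that basis
  (\<open>eigvals_eigenbasis\<close>).
\<close>

section \<open>Orthonormal eigenbases of symmetric matrices\<close>

text \<open>A maximiser \<open>u\<close> of the Rayleigh quotient on the unit sphere of \<open>S\<close>, with maximum \<open>c\<close>, is an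
  eigenvector: the quadratic form \<open>c * (v \<bullet> v) - f v \<bullet> v\<close> is nonnegative on \<open>S\<close> and vanishes at
  \<open>u\<close>, so its derivative at \<open>u\<close> vanishes along \<open>S\<close>.  As \<open>S\<close> is invariant, the gradient
  \<open>c *\<^sub>R u - f u\<close> itself is one of these directions.\<close>

lemma eigenvector_in_invariant_subspace:
  fixes f :: "'a::euclidean_space \<Rightarrow> 'a"
  assumes lin: "linear f" and S: "subspace S" "S \<noteq> {0}" and inv: "f ` S \<subseteq> S"
    and self: "\<And>v w. \<lbrakk>v \<in> S; w \<in> S\<rbrakk> \<Longrightarrow> f v \<bullet> w = v \<bullet> f w"
  obtains u c where "u \<in> S" "norm u = 1" "f u = c *\<^sub>R u"
proof -
  interpret linear f by (fact lin)
  obtain z where z: "z \<in> S" "z \<noteq> 0"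
    using S subspace_0 by blast
  have "z /\<^sub>R norm z \<in> sphere 0 1 \<inter> S"
    using z S(1) by (simp add: subspace_scale)
  moreover have "compact (sphere 0 1 \<inter> S)"
    by (intro compact_Int_closed compact_sphere closed_subspace S)
  moreover have "continuous_on (sphere 0 1 \<inter> S) (\<lambda>v. f v \<bullet> v)"
    by (intro continuous_intros linear_continuous_on lin linear_conv_bounded_linear [THEN iffD1])
  ultimately obtain u where u: "u \<in> S" "norm u = 1"
    and max: "\<And>v. v \<in> S \<Longrightarrow> norm v = 1 \<Longrightarrow> f v \<bullet> v \<le> f u \<bullet> u"
    using continuous_attains_sup [of "sphere 0 1 \<inter> S" "\<lambda>v. f v \<bullet> v"] by fastforce
  define c where "c = f u \<bullet> u"
  have quotient: "f v \<bullet> v \<le> c * (v \<bullet> v)" if "v \<in> S" for v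
  proof (cases "v = 0")
    case False
    define a where "a = inverse (norm v)"
    have "f (a *\<^sub>R v) \<bullet> (a *\<^sub>R v) \<le> c"
      unfolding c_def using that False S(1) by (intro max) (auto simp: a_def subspace_scale)
    then have "a\<^sup>2 * (f v \<bullet> v) \<le> c"
      by (simp add: scale power2_eq_square mult.assoc)
    then show ?thesis
      using False by (simp add: a_def field_simps flip: power2_norm_eq_inner)
  qed simp
  have critical: "(c *\<^sub>R u - f u) \<bullet> w = 0" if w: "w \<in> S" for w
  proof -
    define p where "p = (c *\<^sub>R u - f u) \<bullet> w"
    define q where "q = c * (w \<bullet> w) - f w \<bullet> w"
    have parabola: "0 \<le> 2 * p * t + q * t\<^sup>2" for t
    proof -
      have "u + t *\<^sub>R w \<in> S"
        using u w S(1) by (simp add: subspace_add subspace_scale)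
      from quotient [OF this] have "0 \<le> c * (u \<bullet> u) - f u \<bullet> u + t * (2 * c * (u \<bullet> w) - f u \<bullet> w - f w \<bullet> u) + t\<^sup>2 * q"
        by (simp add: add scale q_def inner_add_left inner_add_right inner_commute algebra_simps power2_eq_square)
      moreover have "f w \<bullet> u = f u \<bullet> w"
        using self [OF u(1) w] by (simp add: inner_commute)
      moreover have "u \<bullet> u = 1"
        using u by (simp add: norm_eq_1)
      ultimately show ?thesis
        by (simp add: p_def c_def algebra_simps)
    qed
    \<comment> \<open>The parabola is tested at the vertex \<open>- p / r\<close> of the larger one \<open>2 p t + r t\<^sup>2\<close>; taking
      \<open>r > \<bar>q\<bar>\<close> keeps \<open>r\<close> positive even when \<open>q = 0\<close>.\<close>
    define r where "r = \<bar>q\<bar> + 1"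
    have r: "r > 0" "q - 2 * r < 0" by (auto simp: r_def)
    define y where "y = p / r"
    have p: "p = r * y" using r(1) by (simp add: y_def)
    from parabola [of "- y"] have "0 \<le> (q - 2 * r) * y\<^sup>2"
      unfolding p by (simp add: power2_eq_square algebra_simps)
    then have "y\<^sup>2 = 0"
      using r(2) by (smt (verit) mult_neg_pos zero_le_power2)
    then have "p = 0" by (simp add: p)
    then show ?thesis by (simp add: p_def)
  qed
  have "c *\<^sub>R u - f u \<in> S"
    using u inv S(1) by (auto intro!: subspace_diff subspace_scale)
  from critical [OF this] have "f u = c *\<^sub>R u"
    by simp
  with u show ?thesis by (rule that)
qed

text \<open>Induction on the dimension: by self-adjointness, the orthogonal complement in \<open>S\<close> of an
  eigenvector is again invariant.\<close>

lemma orthonormal_eigenvectors_of_invariant_subspace: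
  fixes f :: "'a::euclidean_space \<Rightarrow> 'a"
  assumes lin: "linear f" and "subspace S" "f ` S \<subseteq> S"
    and "\<And>v w. \<lbrakk>v \<in> S; w \<in> S\<rbrakk> \<Longrightarrow> f v \<bullet> w = v \<bullet> f w"
  shows "\<exists>B\<subseteq>S. finite B \<and> card B = dim S \<and> pairwise orthogonal B \<and>
    (\<forall>b\<in>B. norm b = 1 \<and> (\<exists>c. f b = c *\<^sub>R b))"
  using assms(2-)
proof (induction "dim S" arbitrary: S)
  case 0
  show ?case
    using 0(1) by (intro exI [of _ "{}"]) simp
next
  case (Suc m)
  have "S \<noteq> {0}" using Suc.hyps(2) by auto
  then obtain u c where u: "u \<in> S" "norm u = 1" "f u = c *\<^sub>R u"
    using eigenvector_in_invariant_subspace [OF lin] Suc.prems by metis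
  define T where "T = {v \<in> S. orthogonal u v}"
  have T: "subspace T"
    using Suc.prems(1) unfolding T_def subspace_def
    by (auto simp: orthogonal_clauses)
  have "T = {y \<in> S. \<forall>x\<in>span {u}. orthogonal x y}"
    by (auto simp: T_def orthogonal_def span_singleton)
  moreover have "u \<noteq> 0" using u by auto
  ultimately have dimT: "dim T = m"
    using dim_subspace_orthogonal_to_vectors [of "span {u}" S] Suc.prems(1) Suc.hyps(2) u
    by (simp add: span_minimal dim_singleton)
  have "f ` T \<subseteq> T"
  proof
    fix y assume "y \<in> f ` T"
    then obtain v where v: "v \<in> S" "u \<bullet> v = 0" "y = f v"
      by (auto simp: T_def orthogonal_def)
    have "u \<bullet> f v = f u \<bullet> v"
      using Suc.prems(3) [OF u(1) v(1)] by simp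
    also have "\<dots> = 0" using u v by simp
    finally show "y \<in> T"
      using v Suc.prems(2) by (auto simp: T_def orthogonal_def)
  qed
  with Suc.hyps(1) [OF dimT [symmetric] T] Suc.prems(3)
  obtain B where B: "B \<subseteq> T" "finite B" "card B = m" "pairwise orthogonal B"
    "\<forall>b\<in>B. norm b = 1 \<and> (\<exists>c. f b = c *\<^sub>R b)"
    unfolding dimT by (auto simp: T_def)
  have "u \<notin> B"
    using B(1) \<open>u \<noteq> 0\<close> by (auto simp: T_def orthogonal_def)
  moreover have "pairwise orthogonal (insert u B)"
    using B(1,4) by (auto simp: pairwise_insert T_def orthogonal_commute)
  ultimately show ?case
    using B u Suc.hyps(2) by (intro exI [of _ "insert u B"]) (auto simp: T_def)
qed

text \<open>The basis is indexed by \<open>'d\<close> so that it can serve as the columns of a square matrix and so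
  that repeated eigenvalues are counted by their indices.\<close>

lemma symmetric_matrix_orthonormal_eigenbasis:
  fixes A :: "real ^ 'd ^ 'd"
  assumes "symmetric_matrix A"
  obtains e :: "'d \<Rightarrow> real ^ 'd" and d
  where "\<And>i j. e i \<bullet> e j = (if i = j then 1 else 0)" "\<And>i. A *v e i = d i *\<^sub>R e i"
proof -
  have "(A *v v) \<bullet> w = v \<bullet> (A *v w)" for v w
    using assms dot_lmul_matrix [of v A w] unfolding symmetric_matrix_def
    by (metis vector_transpose_matrix)
  then obtain B where B: "finite B" "card B = CARD('d)" "pairwise orthogonal B"
    "\<forall>b\<in>B. norm b = 1 \<and> (\<exists>c. A *v b = c *\<^sub>R b)"
    using orthonormal_eigenvectors_of_invariant_subspace [of "(*v) A" UNIV]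
    by (auto simp: matrix_vector_mul_linear)
  from B obtain e where e: "bij_betw e (UNIV :: 'd set) B"
    by (metis finite_class.finite_UNIV finite_same_card_bij)
  have eB: "e i \<in> B" for i using e by (auto simp: bij_betw_def)
  from B(4) obtain c where c: "\<And>b. b \<in> B \<Longrightarrow> A *v b = c b *\<^sub>R b" by metis
  show ?thesis
  proof
    show "e i \<bullet> e j = (if i = j then 1 else 0)" for i j
      using B(3,4) eB [of i] eB [of j] e
      by (auto simp: norm_eq_1 pairwise_def orthogonal_def bij_betw_def inj_eq)
    show "A *v e i = (c \<circ> e) i *\<^sub>R e i" for i
      using c eB by simp
  qed
qed

section \<open>Ordered eigenvalues\<close>

text \<open>The matrix \<open>Q\<close> with columns \<open>e i\<close> is orthogonal and diagonalises \<open>A\<close>, hence the characteristic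
  polynomial splits into the linear factors given by \<open>d\<close>.\<close>

lemma eigvals_eigenbasis:
  fixes A :: "real ^ 'd ^ 'd" and e :: "'d \<Rightarrow> real ^ 'd"
  assumes orth: "\<And>i j. e i \<bullet> e j = (if i = j then 1 else 0)"
    and eig: "\<And>i. A *v e i = d i *\<^sub>R e i"
  shows "eigvals A = image_mset d (mset_set UNIV)"
proof -
  define Q where "Q = transpose (\<chi> j. e j)"
  have QQ: "transpose Q ** Q = mat 1"
    using orth by (simp add: vec_eq_iff transpose_def matrix_matrix_mult_def Q_def mat_def inner_vec_def)
  have detQ: "det (transpose Q) * det Q = 1"
    using QQ by (metis det_I det_mul)
  have "poly (charpoly A) t = poly (\<Prod>i\<in>UNIV. [:- d i, 1:]) t" for t
  proof -
    define D :: "real ^ 'd ^ 'd" where "D = (\<chi> i j. if i = j then t - d i else 0)"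
    have "(mat t - A) *v e j = (t - d j) *\<^sub>R e j" for j
    proof -
      have "mat t *v e j = t *\<^sub>R e j"
        by (simp add: vec_eq_iff matrix_vector_mult_def mat_def if_distrib [of "\<lambda>a. a * _"] cong: if_cong)
      then show ?thesis
        by (simp add: matrix_vector_mult_diff_rdistrib eig scaleR_diff_left)
    qed
    then have "(mat t - A) ** Q = Q ** D"
      by (simp add: vec_eq_iff matrix_matrix_mult_def matrix_vector_mult_def transpose_def Q_def D_def
          if_distrib [of "\<lambda>a. _ * a"] mult.commute cong: if_cong)
    then have "det (mat t - A) * det Q = det D * det Q"
      by (metis det_mul mult.commute)
    moreover have "det D = (\<Prod>i\<in>UNIV. t - d i)"
      by (subst det_diagonal) (auto simp: D_def)
    ultimately show ?thesis
      using detQ by (auto simp: poly_charpoly poly_prod)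
  qed
  then have "charpoly A = (\<Prod>i\<in>UNIV. [:- d i, 1:])"
    by (simp add: poly_eq_poly_eq_iff [symmetric] fun_eq_iff)
  then have "eigvals A = (\<Sum>i\<in>UNIV. {#d i#})"
    by (simp add: eigvals_def proots_prod)
  then show ?thesis by (simp add: sum_unfold_sum_mset)
qed

lemma nth_sorted_le_iff:
  fixes xs :: "'a::linorder list"
  assumes "sorted xs" "i < length xs"
  shows "xs ! i \<le> t \<longleftrightarrow> i < length (filter (\<lambda>a. a \<le> t) xs)"
  using assms
proof (induction xs arbitrary: i)
  case (Cons a xs)
  show ?case
  proof (cases "a \<le> t")
    case True
    with Cons show ?thesis by (cases i) auto
  next
    case False
    with Cons.prems have "filter (\<lambda>a. a \<le> t) (a # xs) = []"
      by (fastforce simp: filter_empty_conv)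
    moreover have "\<not> (a # xs) ! i \<le> t"
      using Cons.prems False by (cases i) (auto dest!: nth_mem)
    ultimately show ?thesis by simp
  qed
qed simp

text \<open>Turns inequalities between ordered eigenvalues into inequalities between cardinalities, which
  are then compared as dimensions of spans of eigenvectors.\<close>

lemma lam_le_iff_card:
  fixes A :: "real ^ 'd ^ 'd"
  assumes "eigvals A = image_mset d (mset_set (UNIV :: 'd set))" "i \<in> {1..CARD('d)}"
  shows "lam i A \<le> t \<longleftrightarrow> i \<le> card {j. d j \<le> t}"
proof -
  define L where "L = sorted_list_of_multiset (eigvals A)"
  have "length L = size (mset L)" by simp
  also have "\<dots> = CARD('d)"
    by (simp only: L_def mset_sorted_list_of_multiset assms(1)) simp
  finally have len: "length L = CARD('d)" .
  have "length (filter (\<lambda>a. a \<le> t) L) = size (filter_mset (\<lambda>a. a \<le> t) (mset L))"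
    by (simp flip: mset_filter)
  also have "\<dots> = card {j. d j \<le> t}"
    by (simp only: L_def mset_sorted_list_of_multiset assms(1)) (simp add: filter_mset_image_mset)
  finally show ?thesis
    using nth_sorted_le_iff [of L "i - 1" t] len assms(2)
      sorted_sorted_list_of_multiset [of "eigvals A"]
    unfolding lam_def L_def [symmetric] by (simp, linarith)
qed

section \<open>Weyl's perturbation inequality\<close>

text \<open>Both quadratic forms are diagonal in the coordinates \<open>a\<close>, so on the span of selected
  eigenvectors the Rayleigh quotient is a weighted mean of the selected eigenvalues.\<close>

lemma span_orthonormal_rayleigh:
  fixes A :: "real ^ 'd ^ 'd" and e :: "'d \<Rightarrow> real ^ 'd"
  assumes orth: "\<And>i j. e i \<bullet> e j = (if i = j then 1 else 0)"
    and eig: "\<And>i. A *v e i = d i *\<^sub>R e i"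
    and v: "v \<in> span (e ` I)"
  obtains a where "v \<bullet> v = (\<Sum>i\<in>I. (a i)\<^sup>2)" "(A *v v) \<bullet> v = (\<Sum>i\<in>I. d i * (a i)\<^sup>2)"
proof -
  have "inj_on e I"
    by (rule inj_onI) (metis orth zero_neq_one)
  with v obtain a where a: "v = (\<Sum>i\<in>I. a i *\<^sub>R e i)"
    by (auto simp: span_finite sum.reindex)
  then have "A *v v = (\<Sum>i\<in>I. (a i * d i) *\<^sub>R e i)"
    by (simp add: linear_sum [OF matrix_vector_mul_linear] linear_scale [OF matrix_vector_mul_linear] eig)
  then show ?thesis
    using a by (intro that [of a])
      (simp_all add: inner_sum_left inner_sum_right orth power2_eq_square mult_ac
        if_distrib [of "\<lambda>a. _ * a"] cong: if_cong)
qed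

lemma dim_span_orthonormal:
  fixes e :: "'d::finite \<Rightarrow> 'a::euclidean_space"
  assumes orth: "\<And>i j. e i \<bullet> e j = (if i = j then 1 else 0)"
  shows "dim (span (e ` I)) = card I"
proof -
  have inj: "inj_on e I"
    by (rule inj_onI) (metis orth zero_neq_one)
  have "0 \<notin> e ` I"
    using orth by (metis imageE inner_zero_left zero_neq_one)
  then have "independent (e ` I)"
    by (intro pairwise_orthogonal_independent) (auto simp: pairwise_def orthogonal_def orth)
  then show ?thesis
    using card_image [OF inj] by (metis dim_span_eq_card_independent)
qed

text \<open>One half of Weyl's inequality; exchanging \<open>A\<close> and \<open>B\<close> gives the other.  The thresholds are
  non-strict for \<open>A\<close> and strict for \<open>B\<close>: a nonzero vector in both spans would then have
  contradictory Rayleigh quotients, and the indices outside \<open>J\<close> are exactly those counted by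
  \<open>lam_le_iff_card\<close>.\<close>

lemma lam_le_add_spectral_norm:
  fixes A B :: "real ^ 'd ^ 'd"
  assumes A: "symmetric_matrix A" and B: "symmetric_matrix B" and i: "i \<in> {1..CARD('d)}"
  shows "lam i B \<le> lam i A + spectral_norm (B - A)"
proof -
  obtain e :: "'d \<Rightarrow> real ^ 'd" and a where e: "\<And>i j. e i \<bullet> e j = (if i = j then 1 else 0)" "\<And>i. A *v e i = a i *\<^sub>R e i"
    by (rule symmetric_matrix_orthonormal_eigenbasis [OF A]) (rule that)
  obtain f :: "'d \<Rightarrow> real ^ 'd" and b where f: "\<And>i j. f i \<bullet> f j = (if i = j then 1 else 0)" "\<And>i. B *v f i = b i *\<^sub>R f i"
    by (rule symmetric_matrix_orthonormal_eigenbasis [OF B]) (rule that)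
  define t where "t = lam i A"
  define r where "r = spectral_norm (B - A)"
  define I where "I = {j. a j \<le> t}"
  define J where "J = {j. t + r < b j}"
  have "v = 0" if V: "v \<in> span (e ` I)" and W: "v \<in> span (f ` J)" for v
  proof (rule ccontr)
    assume "v \<noteq> 0"
    obtain p where p: "v \<bullet> v = (\<Sum>i\<in>I. (p i)\<^sup>2)" "(A *v v) \<bullet> v = (\<Sum>i\<in>I. a i * (p i)\<^sup>2)"
      using span_orthonormal_rayleigh [OF e V] .
    obtain q where q: "v \<bullet> v = (\<Sum>i\<in>J. (q i)\<^sup>2)" "(B *v v) \<bullet> v = (\<Sum>i\<in>J. b i * (q i)\<^sup>2)"
      using span_orthonormal_rayleigh [OF f W] .
    have "(A *v v) \<bullet> v \<le> t * (v \<bullet> v)"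
      unfolding p sum_distrib_left by (intro sum_mono mult_right_mono) (auto simp: I_def)
    moreover have "((B - A) *v v) \<bullet> v \<le> r * (v \<bullet> v)"
    proof -
      have "((B - A) *v v) \<bullet> v \<le> norm ((B - A) *v v) * norm v"
        by (rule norm_cauchy_schwarz)
      also have "\<dots> \<le> (r * norm v) * norm v"
        unfolding r_def spectral_norm_def
        by (intro mult_right_mono onorm matrix_vector_mul_bounded_linear) auto
      finally show ?thesis
        by (simp add: power2_norm_eq_inner [symmetric] power2_eq_square mult.assoc)
    qed
    moreover have "(t + r) * (v \<bullet> v) < (B *v v) \<bullet> v"
    proof -
      obtain j where j: "j \<in> J" "q j \<noteq> 0"
        using q(1) \<open>v \<noteq> 0\<close> by (metis (mono_tags, lifting) inner_eq_zero_iff power_zero_numeral sum.neutral)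
      show ?thesis
        unfolding q sum_distrib_left
        by (rule sum_strict_mono_ex1) (use j in \<open>auto simp: J_def intro!: mult_right_mono bexI [of _ j]\<close>)
    qed
    ultimately show False
      by (simp add: matrix_vector_mult_diff_rdistrib inner_diff_left distrib_right)
  qed
  then have "span (e ` I) \<inter> span (f ` J) \<subseteq> {0}" by blast
  then have "dim (span (e ` I) \<inter> span (f ` J)) = 0" by simp
  then have "card I + card J = dim {x + y |x y. x \<in> span (e ` I) \<and> y \<in> span (f ` J)}"
    using dim_sums_Int [of "span (e ` I)" "span (f ` J)"]
    by (simp only: subspace_span dim_span_orthonormal [OF e(1)] dim_span_orthonormal [OF f(1)]) simp
  also have "\<dots> \<le> CARD('d)"
    by (rule order_trans [OF dim_subset_UNIV]) simp
  finally have "card I + card J \<le> CARD('d)" .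
  moreover have "card (- J) = CARD('d) - card J"
    by (simp add: Compl_eq_Diff_UNIV card_Diff_subset)
  moreover have "i \<le> card I"
    using lam_le_iff_card [OF eigvals_eigenbasis [OF e] i, of t] by (simp add: t_def I_def)
  moreover have "- J = {j. b j \<le> t + r}" by (auto simp: J_def)
  ultimately have "i \<le> card {j. b j \<le> t + r}" by simp
  then show ?thesis
    using lam_le_iff_card [OF eigvals_eigenbasis [OF f] i] by (simp add: t_def r_def)
qed

lemma spectral_norm_minus_commute: "spectral_norm (A - B) = spectral_norm (B - A)"
proof -
  have "(A - B) *v v = - ((B - A) *v v)" for v
    by (simp add: matrix_vector_mult_diff_rdistrib)
  then have "(*v) (A - B) = (\<lambda>v. - ((B - A) *v v))" by blast
  then show ?thesis
    by (simp only: spectral_norm_def onorm_neg)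
qed

lemma abs_lam_diff_le_spectral_norm:
  fixes A B :: "real ^ 'd ^ 'd"
  assumes "symmetric_matrix A" "symmetric_matrix B" "i \<in> {1..CARD('d)}"
  shows "\<bar>lam i B - lam i A\<bar> \<le> spectral_norm (B - A)"
  using lam_le_add_spectral_norm [OF assms] lam_le_add_spectral_norm [OF assms(2,1,3)]
  by (simp add: abs_le_iff spectral_norm_minus_commute [of A B])

section \<open>Persistence of admissible shifts\<close>

theorem proposition4p2:
  fixes H :: "'x \<Rightarrow> real ^ 'd ^ 'd"
    and x :: "nat \<Rightarrow> 'x"
    and n k :: nat
    and lamhat :: "nat \<Rightarrow> nat \<Rightarrow> real"
    and \<epsilon> \<delta> s :: "nat \<Rightarrow> real"
  defines "mhat \<equiv> estimated_margin (lamhat k n) (lamhat (k + 1) n) (s n)"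
    and "gap \<equiv> lam (k + 1) (H (x (n + 1))) - lam k (H (x (n + 1)))"
    and "shat \<equiv> (lamhat k (n + 1) + lamhat (k + 1) (n + 1)) / 2"
  assumes k: "k \<in> {1..CARD('d) - 1}"
    and sym: "symmetric_matrix (H (x n))" "symmetric_matrix (H (x (n + 1)))"
    and est: "\<bar>lamhat k n - lam k (H (x n))\<bar> \<le> \<epsilon> n"
             "\<bar>lamhat (k + 1) n - lam (k + 1) (H (x n))\<bar> \<le> \<epsilon> n"
  shows "(mhat > \<epsilon> n \<longrightarrow>
            admissible H k (x n) (s n) \<and> true_margin H k (x n) (s n) \<ge> mhat - \<epsilon> n)
       \<and> (mhat > \<epsilon> n \<and> endpoint_drift H k (x n) (x (n + 1)) \<le> \<delta> n \<and> \<delta> n < mhat - \<epsilon> n \<longrightarrow>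
            admissible H k (x (n + 1)) (s n) \<and>
            true_margin H k (x (n + 1)) (s n) \<ge> mhat - \<epsilon> n - \<delta> n)
       \<and> (spectral_norm (H (x (n + 1)) - H (x n)) \<le> \<delta> n \<longrightarrow>
            endpoint_drift H k (x n) (x (n + 1)) \<le> \<delta> n)
       \<and> (gap > 0 \<and>
          \<bar>lamhat k (n + 1) - lam k (H (x (n + 1)))\<bar> \<le> \<epsilon> (n + 1) \<and>
          \<bar>lamhat (k + 1) (n + 1) - lam (k + 1) (H (x (n + 1)))\<bar> \<le> \<epsilon> (n + 1) \<and>
          \<epsilon> (n + 1) < gap / 2 \<longrightarrow>
            admissible H k (x (n + 1)) shat)"
proof -
  have margins: "mhat \<le> s n - lamhat k n" "mhat \<le> lamhat (k + 1) n - s n"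
    by (simp_all add: mhat_def estimated_margin_def)
  have drift_le_iff: "endpoint_drift H k (x n) (x (n + 1)) \<le> \<delta> n \<longleftrightarrow>
      \<bar>lam k (H (x (n + 1))) - lam k (H (x n))\<bar> \<le> \<delta> n \<and>
      \<bar>lam (k + 1) (H (x (n + 1))) - lam (k + 1) (H (x n))\<bar> \<le> \<delta> n"
    by (simp add: endpoint_drift_def)
  show ?thesis
  proof (intro conjI impI; (elim conjE)?)
    assume "mhat > \<epsilon> n"
    then show "admissible H k (x n) (s n)" "true_margin H k (x n) (s n) \<ge> mhat - \<epsilon> n"
      using margins est unfolding admissible_def true_margin_def greaterThanLessThan_iff by linarith+
  next
    assume "endpoint_drift H k (x n) (x (n + 1)) \<le> \<delta> n" "\<delta> n < mhat - \<epsilon> n"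
    then show "admissible H k (x (n + 1)) (s n)"
      "true_margin H k (x (n + 1)) (s n) \<ge> mhat - \<epsilon> n - \<delta> n"
      using margins est unfolding drift_le_iff admissible_def true_margin_def greaterThanLessThan_iff
      by linarith+
  next
    assume "spectral_norm (H (x (n + 1)) - H (x n)) \<le> \<delta> n"
    moreover have "k \<in> {1..CARD('d)}" "k + 1 \<in> {1..CARD('d)}"
      using k by auto
    ultimately show "endpoint_drift H k (x n) (x (n + 1)) \<le> \<delta> n"
      unfolding drift_le_iff using abs_lam_diff_le_spectral_norm [OF sym] order_trans by blast
  next
    assume "\<bar>lamhat k (n + 1) - lam k (H (x (n + 1)))\<bar> \<le> \<epsilon> (n + 1)"
      "\<bar>lamhat (k + 1) (n + 1) - lam (k + 1) (H (x (n + 1)))\<bar> \<le> \<epsilon> (n + 1)"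
      "\<epsilon> (n + 1) < gap / 2"
    then show "admissible H k (x (n + 1)) shat"
      unfolding admissible_def greaterThanLessThan_iff shat_def gap_def by (simp add: abs_le_iff field_simps)
  qed
qed

end
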